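(* Let $X$ be a Lindelöf $\Sigma$-space. Then every subspace of $C_p(X)$ is a $D$-space (that is, $C_p(X)$ is hereditarily a $D$-space).
   Context: A space $X$ is a Lindelöf $\Sigma$-space if there are a cover $\mathcal K$ of $X$ by compact sets and a countable collection $\mathcal F$ of subsets of $X$ such that, whenever $K\in\mathcal K$ and $K\subset U$ with $U$ open in $X$, there is $F\in\mathcal F$ with $K\subset F\subset U$. $C_p(X)$ is the set $C(X)$ of continuous real-valued functions on $X$ with the topology of pointwise convergence. A neighborhood assignment on a space $Y$ is a family $\{N(y):y\in Y\}$ of subsets of $Y$ with $y\in \operatorname{Int} N(y)$ for each $y\in Y$. A space $Y$ is a $D$-space if for every neighborhood assignment $\{N(y):y\in Y\}$ on $Y$ there is a closed discrete subset $D$ of $Y$ such that $Y=\bigcup\{N(y):y\in D\}$. *)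

theory Defs
  imports "HOL-Analysis.Analysis"
begin

definition lindelof_Sigma_space :: "'a topology \<Rightarrow> bool" where
  "lindelof_Sigma_space X \<longleftrightarrow>
     (\<exists>\<K> \<F>. (\<forall>K\<in>\<K>. compactin X K) \<and> \<Union>\<K> = topspace X \<and>
            countable \<F> \<and> (\<forall>F\<in>\<F>. F \<subseteq> topspace X) \<and>
            (\<forall>K\<in>\<K>. \<forall>U. openin X U \<and> K \<subseteq> U \<longrightarrow> (\<exists>F\<in>\<F>. K \<subseteq> F \<and> F \<subseteq> U)))"

(* The points of the product topology are the functions that are undefined outside
   topspace X, so each continuous real-valued function on X is represented exactly once. *)
definition Cp :: "'a topology \<Rightarrow> ('a \<Rightarrow> real) topology" where
  "Cp X = subtopology (product_topology (\<lambda>_. euclideanreal) (topspace X))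
            {f. continuous_map X euclideanreal f}"

lemma topspace_Cp:
  "topspace (Cp X) = {f \<in> extensional (topspace X). continuous_map X euclideanreal f}"
  by (auto simp: Cp_def PiE_def)

(* A neighborhood assignment is a family indexed by topspace Y; values of N elsewhere
   are irrelevant. *)
definition neighborhood_assignment :: "'a topology \<Rightarrow> ('a \<Rightarrow> 'a set) \<Rightarrow> bool" where
  "neighborhood_assignment Y N \<longleftrightarrow>
     (\<forall>y\<in>topspace Y. N y \<subseteq> topspace Y \<and> y \<in> Y interior_of N y)"

definition closed_discrete_in :: "'a topology \<Rightarrow> 'a set \<Rightarrow> bool" where
  "closed_discrete_in Y D \<longleftrightarrow> closedin Y D \<and> subtopology Y D = discrete_topology D"

definition D_space :: "'a topology \<Rightarrow> bool" where
  "D_space Y \<longleftrightarrow>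
     (\<forall>N. neighborhood_assignment Y N \<longrightarrow>
          (\<exists>D. closed_discrete_in Y D \<and> topspace Y = (\<Union>y\<in>D. N y)))"

end

theory Submission
  imports Defs
begin

text \<open>
  The proof passes through an intermediate property, a version of monotone monolithicity:
  finite subsets B of a space Y are assigned countable families W B such that, whenever y is
  in the closure of A and U is a neighborhood of y, some V in W B with B a finite subset of A
  satisfies \<open>y \<in> V \<subseteq> U\<close>. It passes to subspaces.

  Function spaces over Lindeloef \<Sigma>-spaces have it
  (\<open>monolithic_operator_Cp\<close>). Let f be a limit of A whose value at x is near a
  rational q, let K be a compact member of the cover with x in K, and discard the members of A
  that are not near q at x. By compactness there are finitely many functions B in A such that,
  at every point of K where all of them are near q, f is near q as well, and the network
  replaces K by a member F of a countable family. All functions h that satisfy this condition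
  on F are near q at x, because x is a point of F where all members of B are near q. So the
  set of these h contains f and lies in the given neighborhood, and apart from B it depends
  only on the countably many choices of F, q and the error bound. Neighborhoods that restrict
  several coordinates are dealt with by discarding members of A for all of them at once and
  intersecting finitely many such sets.

  A T1 space with this property is a D-space (\<open>D_space_if_monolithic\<close>). Given an
  open neighborhood assignment N, points are selected one after the other outside the part
  that is covered already. The resulting set is closed and discrete provided that, at every
  limit stage and at the end, the limit points of the selection D made so far are covered by
  D: then the first selected point whose neighborhood contains a given point y yields a
  neighborhood of y that misses all later selections, and the earlier ones do not accumulate
  at y. A limit point y of D has a set V in some W B, B a finite subset of D, with \<open>y
  \<in> V \<subseteq> N y\<close>. So it suffices that, for each such V, all y with \<open>y
  \<in> V \<subseteq> N y\<close> get covered, and selecting a single uncovered one of them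
  achieves that, since its neighborhood contains V. For countably many V this can be arranged
  in a sequence (\<open>sticky_countable\<close>). The general case is an induction on the
  number of sets V to be dealt with (\<open>sticky_exists_infinite\<close>), in which
  selections closed under this process are extended along a well-order whose proper initial
  segments all have smaller cardinality. Restricting each extension to the part of the space
  that is not yet covered keeps the earlier selections intact.
\<close>

section \<open>Monotonically monolithic spaces\<close>

text \<open>
  A finitary form of monotone monolithicity: the countable families attached to the finite
  subsets of A together contain a network at every point of the closure of A. The point of the
  definition is that a limit point of A, together with any neighborhood of it, is caught by
  one of only countably many sets once a suitable finite part of A is known.
\<close>
definition monolithic_operator :: "'a topology \<Rightarrow> ('a set \<Rightarrow> 'a set set) \<Rightarrow> bool" where
  "monolithic_operator Y W \<longleftrightarrow>
     (\<forall>B. countable (W B)) \<and>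
     (\<forall>A y U. A \<subseteq> topspace Y \<and> y \<in> Y closure_of A \<and> openin Y U \<and> y \<in> U \<longrightarrow>
        (\<exists>B V. finite B \<and> B \<subseteq> A \<and> V \<in> W B \<and> y \<in> V \<and> V \<subseteq> U))"

lemma monolithic_operator_subtopology:
  assumes W: "monolithic_operator Y W" and S: "S \<subseteq> topspace Y"
  shows "monolithic_operator (subtopology Y S) (\<lambda>B. (\<inter>) S ` W B)"
  unfolding monolithic_operator_def
proof (intro conjI allI impI)
  show "countable ((\<inter>) S ` W B)" for B
    using W by (auto simp: monolithic_operator_def)
next
  fix A y U
  assume *: "A \<subseteq> topspace (subtopology Y S) \<and> y \<in> subtopology Y S closure_of A \<and>
             openin (subtopology Y S) U \<and> y \<in> U"
  then obtain U' where U': "openin Y U'" "U = U' \<inter> S"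
    by (auto simp: openin_subtopology)
  have "y \<in> Y closure_of A" "A \<subseteq> topspace Y"
    using * closure_of_subtopology_subset by fastforce+
  then obtain B V where "finite B" "B \<subseteq> A" "V \<in> W B" "y \<in> V" "V \<subseteq> U'"
    using W * U' unfolding monolithic_operator_def by blast
  then show "\<exists>B V. finite B \<and> B \<subseteq> A \<and> V \<in> (\<inter>) S ` W B \<and> y \<in> V \<and> V \<subseteq> U"
    using * U' by (intro exI[of _ B] exI[of _ "S \<inter> V"]) auto
qed

section \<open>Neighborhood assignments on monotonically monolithic spaces\<close>

lemma closed_discrete_in_if_locally_finite:
  assumes "t1_space Y" "D \<subseteq> topspace Y"
    and "\<And>y. y \<in> topspace Y \<Longrightarrow> \<exists>U. openin Y U \<and> y \<in> U \<and> finite (U \<inter> D)"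
  shows "closed_discrete_in Y D"
proof -
  have "Y derived_set_of D = {}"
  proof (rule ccontr)
    assume "Y derived_set_of D \<noteq> {}"
    then obtain y where y: "y \<in> Y derived_set_of D" by auto
    then have yY: "y \<in> topspace Y" by (simp add: in_derived_set_of)
    with assms(3) obtain U where U: "openin Y U" "y \<in> U" "finite (U \<inter> D)" by blast
    have "closedin Y (U \<inter> D - {y})"
      using U assms(1,2) by (intro t1_space_closedin_finite[THEN iffD1, rule_format]) auto
    then have "openin Y (U - (U \<inter> D - {y}))" using U(1) by (rule openin_diff[rotated])
    moreover have "y \<in> U - (U \<inter> D - {y})" using U(2) by blast
    ultimately obtain z where "z \<noteq> y" "z \<in> D" "z \<in> U - (U \<inter> D - {y})"
      using y unfolding in_derived_set_of by metis
    then show False by blast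
  qed
  then show ?thesis
    using assms(2)
    by (simp add: closed_discrete_in_def closedin_contains_derived_set
        subtopology_eq_discrete_topology_eq)
qed

text \<open>
  Replacing each set of a neighborhood assignment by its interior loses nothing, so the
  assignment is taken to consist of open sets from here on.
\<close>
locale open_assignment_on_monolithic =
  fixes Y :: "'a topology" and W :: "'a set \<Rightarrow> 'a set set" and N :: "'a \<Rightarrow> 'a set"
  assumes W: "monolithic_operator Y W"
    and N: "\<And>y. y \<in> topspace Y \<Longrightarrow> openin Y (N y) \<and> y \<in> N y"
begin

definition cov :: "'a set \<Rightarrow> 'a set" where
  "cov D = (\<Union>y\<in>D. N y)"

text \<open>
  A task is a set V taken from a family attached to a finite subset of D. It is handled on S
  by D when every point y of S that V could catch (y in V, V inside N y) is covered. If some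
  such y is uncovered, adding y to D handles the task for good: every other such point lies in
  V and hence in N y. This is why a countable family of tasks costs only countably many
  points.
\<close>
definition tasks :: "'a set \<Rightarrow> 'a set set" where
  "tasks D = (\<Union>B\<in>{B. finite B \<and> B \<subseteq> D}. W B)"

definition handles :: "'a set \<Rightarrow> 'a set \<Rightarrow> 'a set \<Rightarrow> bool" where
  "handles S D V \<longleftrightarrow> (\<forall>y\<in>S \<inter> V. V \<subseteq> N y \<longrightarrow> y \<in> cov D)"

text \<open>
  An end extension adds only points outside the part that is already covered. Hence the open
  set covered by D meets every end extension of D in a subset of D, so that local finiteness
  at a covered point is never spoiled later.
\<close>
definition end_ext :: "'a set \<Rightarrow> 'a set \<Rightarrow> bool"  (infix "\<sqsubseteq>" 50) where
  "D \<sqsubseteq> E \<longleftrightarrow> D \<subseteq> E \<and> E \<inter> cov D \<subseteq> D"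

definition loc_fin :: "'a set \<Rightarrow> 'a set \<Rightarrow> bool" where
  "loc_fin S D \<longleftrightarrow> D \<subseteq> S \<and> (\<forall>y\<in>S. \<exists>U. openin Y U \<and> y \<in> U \<and> finite (U \<inter> D))"

text \<open>
  A union of a chain of locally finite end extensions can have limit points. If all its tasks
  are handled, then these limit points would be covered, and hence lie in an open set covered
  by a single member of the chain, which the union meets in a locally finite set. Handling
  tasks is thus what carries local finiteness through limit stages. The set S varies because
  constructions are repeated on the part of the space that is not yet covered.
\<close>
definition sticky :: "'a set \<Rightarrow> 'a set \<Rightarrow> bool" where
  "sticky S D \<longleftrightarrow> loc_fin S D \<and> (\<forall>V\<in>tasks D. handles S D V)"

lemma cov_mono: "D \<subseteq> E \<Longrightarrow> cov D \<subseteq> cov E"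
  by (auto simp: cov_def)

lemma cov_Un: "cov (D \<union> E) = cov D \<union> cov E"
  by (auto simp: cov_def)

lemma cov_Union: "cov (\<Union>\<C>) = (\<Union>C\<in>\<C>. cov C)"
  by (auto simp: cov_def)

lemma openin_cov: "D \<subseteq> topspace Y \<Longrightarrow> openin Y (cov D)"
  using N by (auto simp: cov_def)

lemma tasks_mono: "D \<subseteq> E \<Longrightarrow> tasks D \<subseteq> tasks E"
  unfolding tasks_def by blast

lemma handles_mono: "handles S D V \<Longrightarrow> D \<subseteq> E \<Longrightarrow> handles S E V"
  using cov_mono unfolding handles_def by blast

lemma end_ext_refl: "D \<sqsubseteq> D"
  by (auto simp: end_ext_def)

lemma end_ext_trans: "A \<sqsubseteq> B \<Longrightarrow> B \<sqsubseteq> C \<Longrightarrow> A \<sqsubseteq> C"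
  using cov_mono[of A B] unfolding end_ext_def by blast

lemma end_ext_Union:
  assumes "D \<in> \<C>" and "\<And>C. C \<in> \<C> \<Longrightarrow> C \<sqsubseteq> D \<or> D \<sqsubseteq> C"
  shows "D \<sqsubseteq> \<Union>\<C>"
proof -
  have "C \<inter> cov D \<subseteq> D" if "C \<in> \<C>" for C
    using assms(2)[OF that] by (auto simp: end_ext_def)
  then show ?thesis using assms(1) by (auto simp: end_ext_def)
qed

text \<open>
  A task depends on finitely many points only, so it belongs to a member of the chain.
\<close>
lemma tasks_Union_chain:
  assumes ne: "\<C> \<noteq> {}" and chain: "\<And>C C'. C \<in> \<C> \<Longrightarrow> C' \<in> \<C> \<Longrightarrow> C \<sqsubseteq> C' \<or> C' \<sqsubseteq> C"
  shows "tasks (\<Union>\<C>) = (\<Union>C\<in>\<C>. tasks C)"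
proof
  show "tasks (\<Union>\<C>) \<subseteq> (\<Union>C\<in>\<C>. tasks C)"
  proof
    fix V assume "V \<in> tasks (\<Union>\<C>)"
    then obtain B where B: "finite B" "B \<subseteq> \<Union>\<C>" "V \<in> W B" by (auto simp: tasks_def)
    have "subset.chain UNIV \<C>"
      using chain unfolding subset_chain_def end_ext_def by blast
    then obtain C where "C \<in> \<C>" "B \<subseteq> C"
      using finite_subset_Union_chain[OF B(1,2) ne] by metis
    then show "V \<in> (\<Union>C\<in>\<C>. tasks C)" using B by (auto simp: tasks_def)
  qed
qed (use tasks_mono in blast)

lemma finite_loc_fin:
  assumes "S \<subseteq> topspace Y" "finite D" "D \<subseteq> S"
  shows "loc_fin S D"
  using assms unfolding loc_fin_def by (metis finite_Int openin_topspace subsetD)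

text \<open>
  This is the reason for the notion of a task: if y is a limit point of D, the network at y
  supplies a task V of D with y in V and V inside N y, and handling V means covering y.
\<close>
lemma cluster_point_in_cov:
  assumes S: "S \<subseteq> topspace Y" and D: "D \<subseteq> S" "\<And>V. V \<in> tasks D \<Longrightarrow> handles S D V"
    and y: "y \<in> S" "y \<in> Y closure_of D"
  shows "y \<in> cov D"
proof -
  have "openin Y (N y)" "y \<in> N y" using N y S by auto
  moreover have "D \<subseteq> topspace Y" using D S by auto
  ultimately obtain B V where "finite B" "B \<subseteq> D" "V \<in> W B" "y \<in> V" "V \<subseteq> N y"
    using W y unfolding monolithic_operator_def by meson
  then show ?thesis using D(2)[of V] y(1) by (auto simp: tasks_def handles_def)
qed

text \<open>
  At a point covered by a member C of the chain, the open set covered by C meets the union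
  only in C. An uncovered point is not a limit point at all, since the tasks are handled.
\<close>
lemma sticky_Union_chain:
  assumes S: "S \<subseteq> topspace Y"
    and chain: "\<And>C C'. C \<in> \<C> \<Longrightarrow> C' \<in> \<C> \<Longrightarrow> C \<sqsubseteq> C' \<or> C' \<sqsubseteq> C"
    and lf: "\<And>C. C \<in> \<C> \<Longrightarrow> loc_fin S C"
    and h: "\<And>V. V \<in> tasks (\<Union>\<C>) \<Longrightarrow> handles S (\<Union>\<C>) V"
  shows "sticky S (\<Union>\<C>)"
proof -
  have sub: "\<Union>\<C> \<subseteq> S" using lf by (auto simp: loc_fin_def)
  have "\<exists>U. openin Y U \<and> y \<in> U \<and> finite (U \<inter> \<Union>\<C>)" if y: "y \<in> S" for y
  proof (cases "y \<in> cov (\<Union>\<C>)")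
    case False
    then have "y \<notin> Y closure_of \<Union>\<C>"
      using cluster_point_in_cov[OF S sub h] y by blast
    moreover have "y \<in> topspace Y" using y S by auto
    ultimately obtain U where U: "openin Y U" "y \<in> U" "U \<inter> \<Union>\<C> = {}"
      unfolding in_closure_of by blast
    then show ?thesis by (intro exI[of _ U]) simp
  next
    case True
    then obtain C where C: "C \<in> \<C>" "y \<in> cov C" by (auto simp: cov_Union)
    then obtain U where U: "openin Y U" "y \<in> U" "finite (U \<inter> C)"
      using lf y unfolding loc_fin_def by blast
    have "C \<sqsubseteq> \<Union>\<C>" using end_ext_Union C chain by blast
    then have "U \<inter> cov C \<inter> \<Union>\<C> \<subseteq> U \<inter> C" by (auto simp: end_ext_def)
    moreover have "openin Y (cov C)" using openin_cov sub S C by blast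
    ultimately have "openin Y (U \<inter> cov C)" "finite (U \<inter> cov C \<inter> \<Union>\<C>)"
      using U finite_subset by blast+
    then show ?thesis using U C by blast
  qed
  then show ?thesis using sub h by (auto simp: sticky_def loc_fin_def)
qed

lemma sticky_Union_seq:
  fixes D :: "nat \<Rightarrow> 'a set"
  assumes S: "S \<subseteq> topspace Y" and lf: "\<And>n. loc_fin S (D n)"
    and ext: "\<And>n. D n \<sqsubseteq> D (Suc n)"
    and h: "\<And>V m. V \<in> tasks (D m) \<Longrightarrow> \<exists>n. handles S (D n) V"
  shows "sticky S (\<Union>n. D n)" "D m \<sqsubseteq> (\<Union>n. D n)"
proof -
  have le: "D m \<sqsubseteq> D n" if "m \<le> n" for m n
    using that by (induction n rule: dec_induct) (auto intro: end_ext_refl end_ext_trans ext)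
  then have chain: "C \<sqsubseteq> C' \<or> C' \<sqsubseteq> C" if "C \<in> range D" "C' \<in> range D" for C C'
    using that by (metis imageE nle_le)
  show "D m \<sqsubseteq> (\<Union>n. D n)"
    using end_ext_Union[of "D m" "range D"] chain by blast
  show "sticky S (\<Union>n. D n)"
  proof (rule sticky_Union_chain[OF S chain])
    fix V assume "V \<in> tasks (\<Union> (range D))"
    then obtain m where "V \<in> tasks (D m)"
      using tasks_Union_chain[of "range D"] chain by blast
    then obtain n where "handles S (D n) V" using h by blast
    then show "handles S (\<Union> (range D)) V" by (rule handles_mono) auto
  qed (use lf in auto)
qed

lemma handle_one:
  assumes "S \<subseteq> topspace Y" "D \<subseteq> S" "finite D"
  shows "\<exists>E. finite E \<and> E \<subseteq> S \<and> D \<sqsubseteq> E \<and> handles S E V"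
proof (cases "handles S D V")
  case False
  then obtain y where y: "y \<in> S" "y \<in> V" "V \<subseteq> N y" "y \<notin> cov D" by (auto simp: handles_def)
  then have "D \<sqsubseteq> insert y D" "handles S (insert y D) V"
    by (auto simp: end_ext_def handles_def cov_def)
  then show ?thesis using assms y by (intro exI[of _ "insert y D"]) auto
qed (use assms end_ext_refl in blast)

lemma handle_finitely_many:
  assumes S: "S \<subseteq> topspace Y" "D \<subseteq> S" "finite D" and "finite \<T>"
  shows "\<exists>E. finite E \<and> E \<subseteq> S \<and> D \<sqsubseteq> E \<and> (\<forall>V\<in>\<T>. handles S E V)"
  using \<open>finite \<T>\<close>
proof induction
  case empty
  then show ?case using assms end_ext_refl by blast
next
  case (insert V \<T>)
  then obtain E where E: "finite E" "E \<subseteq> S" "D \<sqsubseteq> E" "\<forall>V\<in>\<T>. handles S E V" by blast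
  then obtain E' where E': "finite E'" "E' \<subseteq> S" "E \<sqsubseteq> E'" "handles S E' V"
    using handle_one[OF S(1) E(2,1), of V] by blast
  have "E \<subseteq> E'" using E'(3) by (simp add: end_ext_def)
  then have "\<forall>U\<in>insert V \<T>. handles S E' U" using E(4) E'(4) handles_mono by blast
  then show ?case
    using end_ext_trans[OF E(3) E'(3)] E'(1,2) by blast
qed

text \<open>
  A finite set has countably many tasks. Given an enumeration of the tasks attached to each
  set, stage n handles those of index at most n that are attached to one of the finitely many
  subsets of the current finite set, so that no task of the union is forgotten.
\<close>
lemma sticky_countable:
  assumes S: "S \<subseteq> topspace Y" and T: "countable \<T>"
  shows "\<exists>D. sticky S D \<and> countable D \<and> (\<forall>V\<in>\<T>. handles S D V)"
proof -
  \<comment> \<open>Inserting the empty task makes the enumerated set nonempty; the empty set catches no point.\<close>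
  define e where "e B = from_nat_into (insert {} \<T> \<union> W B)" for B
  have range_e: "range (e B) = insert {} \<T> \<union> W B" for B
    using T W unfolding e_def monolithic_operator_def by (intro range_from_nat_into) auto
  define P where "P n D E \<longleftrightarrow> D \<sqsubseteq> E \<and> (\<forall>B k. B \<subseteq> D \<and> k \<le> n \<longrightarrow> handles S E (e B k))"
    for n :: nat and D E
  have "\<exists>f. \<forall>n. (finite (f n) \<and> f n \<subseteq> S) \<and> P n (f n) (f (Suc n))"
  proof (rule dependent_nat_choice)
    fix D n assume D: "finite D \<and> D \<subseteq> S"
    let ?T = "(\<lambda>(B, k). e B k) ` (Pow D \<times> {..n})"
    have "finite ?T" using D by auto
    then obtain E where "finite E" "E \<subseteq> S" "D \<sqsubseteq> E" "\<forall>V\<in>?T. handles S E V"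
      using handle_finitely_many[OF S, of D ?T] D by blast
    then show "\<exists>E. (finite E \<and> E \<subseteq> S) \<and> P n D E"
      unfolding P_def by (intro exI[of _ E]) force
  qed (rule exI[of _ "{}"], simp)
  then obtain f where f: "\<And>n. finite (f n)" "\<And>n. f n \<subseteq> S" "\<And>n. P n (f n) (f (Suc n))"
    by blast
  have mono: "f m \<subseteq> f n" if "m \<le> n" for m n
    using that
  proof (rule lift_Suc_mono_le[rotated])
    show "f n \<subseteq> f (Suc n)" for n using f(3)[of n] by (simp add: P_def end_ext_def)
  qed
  have h: "\<exists>n. handles S (f n) V" if V: "V \<in> insert {} \<T> \<union> W B" and B: "B \<subseteq> f m" for V B m
  proof -
    obtain k where k: "V = e B k" using V range_e[of B] by blast
    have "B \<subseteq> f (max m k)" using B mono[of m "max m k"] by auto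
    then have "handles S (f (Suc (max m k))) (e B k)"
      using f(3)[of "max m k"] by (simp add: P_def)
    then show ?thesis using k by blast
  qed
  have "sticky S (\<Union>n. f n)"
  proof (rule sticky_Union_seq[OF S])
    show "loc_fin S (f n)" for n
      using S f(1)[of n] f(2)[of n] by (intro finite_loc_fin)
    show "f n \<sqsubseteq> f (Suc n)" for n using f(3)[of n] by (simp add: P_def)
    show "\<exists>n. handles S (f n) V" if V: "V \<in> tasks (f m)" for V m
    proof -
      obtain B where "B \<subseteq> f m" "V \<in> W B"
        using V by (auto simp: tasks_def)
      then show ?thesis using h[of V B m] by blast
    qed
  qed
  moreover have "handles S (\<Union>n. f n) V" if V: "V \<in> \<T>" for V
  proof -
    obtain n where "handles S (f n) V" using h[of V "{}" 0] V by blast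
    then show ?thesis by (rule handles_mono) auto
  qed
  moreover have "countable (\<Union>n. f n)"
    using countable_finite[OF f(1)] by (intro countable_UN) auto
  ultimately show ?thesis by blast
qed

end

section \<open>Transfinite construction of sticky sets\<close>

unbundle cardinal_syntax

lemma countable_ordLeq_infinite:
  assumes "countable A" "infinite M"
  shows "|A| \<le>o |M|"
proof -
  have "|A| \<le>o |UNIV :: nat set|"
    using assms(1) by (auto simp: countable_def card_of_ordLeq[symmetric])
  then show ?thesis
    using assms(2) infinite_iff_card_of_nat ordLeq_transitive by blast
qed

lemma card_of_Un_ordLeq:
  assumes "infinite M" "|A| \<le>o |M|" "|B| \<le>o |M|"
  shows "|A \<union> B| \<le>o |M|"
proof -
  have "|UNIV :: bool set| \<le>o |M|"
    using assms(1) by (intro countable_ordLeq_infinite) auto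
  then have "|\<Union>b\<in>(UNIV :: bool set). if b then A else B| \<le>o |M|"
    using assms by (intro card_of_UNION_ordLeq_infinite) auto
  also have "(\<Union>b\<in>(UNIV :: bool set). if b then A else B) = A \<union> B" by (auto split: if_splits)
  finally show ?thesis .
qed

lemma card_of_finite_subsets_ordLeq:
  assumes M: "infinite M" and D: "|D| \<le>o |M|"
  shows "|{B. finite B \<and> B \<subseteq> D}| \<le>o |M|"
proof -
  define F where "F n = {B. finite B \<and> B \<subseteq> D \<and> card B = n}" for n
  have "|F n| \<le>o |M|" for n
  proof (induction n)
    case 0
    have "finite (F 0)" by (rule finite_subset[of _ "{{}}"]) (auto simp: F_def)
    then show ?case using M by (intro countable_ordLeq_infinite countable_finite)
  next
    case (Suc n)
    have "F (Suc n) \<subseteq> (\<lambda>(x, B). insert x B) ` (D \<times> F n)"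
    proof
      fix B assume B: "B \<in> F (Suc n)"
      then obtain x where x: "x \<in> B" by (force simp: F_def)
      have "B - {x} \<in> F n" using B x by (auto simp: F_def)
      moreover have "x \<in> D" "insert x (B - {x}) = B" using x B by (auto simp: F_def)
      ultimately show "B \<in> (\<lambda>(x, B). insert x B) ` (D \<times> F n)"
        by (intro image_eqI[of _ _ "(x, B - {x})"]) simp_all
    qed
    then have "|F (Suc n)| \<le>o |(\<lambda>(x, B). insert x B) ` (D \<times> F n)|" by (rule card_of_mono1)
    also have "|(\<lambda>(x, B). insert x B) ` (D \<times> F n)| \<le>o |D \<times> F n|" by (rule card_of_image)
    also have "|D \<times> F n| \<le>o |M|"
      using M D Suc by (intro card_of_Sigma_ordLeq_infinite) auto
    finally show ?case .
  qed
  then have "|\<Union>n. F n| \<le>o |M|"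
    using M by (intro card_of_UNION_ordLeq_infinite) (auto simp: infinite_iff_card_of_nat)
  also have "(\<Union>n. F n) = {B. finite B \<and> B \<subseteq> D}" by (auto simp: F_def)
  finally show ?thesis .
qed

context open_assignment_on_monolithic
begin

lemma card_of_tasks_ordLeq:
  assumes M: "infinite M" and D: "|D| \<le>o |M|"
  shows "|tasks D| \<le>o |M|"
  unfolding tasks_def
  using M card_of_finite_subsets_ordLeq[OF M D] W countable_ordLeq_infinite
  by (intro card_of_UNION_ordLeq_infinite) (auto simp: monolithic_operator_def)

lemma sticky_Union_chain_sticky:
  assumes S: "S \<subseteq> topspace Y" and ne: "\<C> \<noteq> {}"
    and chain: "\<And>C C'. C \<in> \<C> \<Longrightarrow> C' \<in> \<C> \<Longrightarrow> C \<sqsubseteq> C' \<or> C' \<sqsubseteq> C"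
    and st: "\<And>C. C \<in> \<C> \<Longrightarrow> sticky S C"
  shows "sticky S (\<Union>\<C>)"
proof (rule sticky_Union_chain[OF S chain])
  show "loc_fin S C" if "C \<in> \<C>" for C using st[OF that] by (simp add: sticky_def)
  show "handles S (\<Union>\<C>) V" if V: "V \<in> tasks (\<Union>\<C>)" for V
  proof -
    obtain C where C: "C \<in> \<C>" "V \<in> tasks C"
      using V tasks_Union_chain[OF ne chain] by auto
    then have "handles S C V" using st by (simp add: sticky_def)
    then show ?thesis using C(1) by (rule handles_mono[OF _ Union_upper])
  qed
qed

text \<open>
  A construction relative to the uncovered part of S can be put on top of D: at points that D
  covers the new points stay away, and at all other points both parts are locally finite.
\<close>
lemma loc_fin_step:
  assumes S: "S \<subseteq> topspace Y" and D: "loc_fin S D" and E: "loc_fin (S - cov D) E"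
  shows "loc_fin S (D \<union> E)" "D \<sqsubseteq> D \<union> E"
    "handles (S - cov D) E V \<Longrightarrow> handles S (D \<union> E) V"
proof -
  have DS: "D \<subseteq> S" and ES: "E \<subseteq> S" "E \<inter> cov D = {}" using D E by (auto simp: loc_fin_def)
  show "D \<sqsubseteq> D \<union> E" using ES by (auto simp: end_ext_def)
  show "handles S (D \<union> E) V" if "handles (S - cov D) E V"
    using that by (auto simp: handles_def cov_Un)
  have "\<exists>U. openin Y U \<and> y \<in> U \<and> finite (U \<inter> (D \<union> E))" if y: "y \<in> S" for y
  proof -
    obtain U where U: "openin Y U" "y \<in> U" "finite (U \<inter> D)"
      using D y by (auto simp: loc_fin_def)
    obtain U' where U': "openin Y U'" "y \<in> U'" "finite (U' \<inter> E)"
    proof (cases "y \<in> cov D")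
      case True
      have "openin Y (cov D)" using openin_cov DS S by blast
      then show ?thesis using that[of "cov D"] True ES by (simp add: Int_commute)
    next
      case False
      then have "y \<in> S - cov D" using y by blast
      then obtain U' where "openin Y U'" "y \<in> U'" "finite (U' \<inter> E)"
        using E unfolding loc_fin_def by metis
      then show ?thesis by (rule that)
    qed
    have "U \<inter> U' \<inter> (D \<union> E) \<subseteq> (U \<inter> D) \<union> (U' \<inter> E)" by blast
    then have "finite (U \<inter> U' \<inter> (D \<union> E))" using U(3) U'(3) finite_subset by blast
    then show ?thesis using U U' by (intro exI[of _ "U \<inter> U'"]) auto
  qed
  then show "loc_fin S (D \<union> E)" using DS ES by (simp add: loc_fin_def)
qed

text \<open>
  Handling the tasks of D produces new points and thereby new tasks, which involve old and new
  points simultaneously. Handling the tasks of the current set again and again, each time on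
  the uncovered part only, closes off after countably many rounds; at every round there are at
  most as many tasks as M has elements, so the cardinality stays bounded by that of M.
\<close>
lemma sticky_extension:
  fixes M :: "'a set set"
  assumes S: "S \<subseteq> topspace Y" and M: "infinite M"
    and ex: "\<And>S \<T>. S \<subseteq> topspace Y \<Longrightarrow> |\<T>| \<le>o |M| \<Longrightarrow>
               \<exists>D. sticky S D \<and> |D| \<le>o |M| \<and> (\<forall>V\<in>\<T>. handles S D V)"
    and D0: "loc_fin S D0" "|D0| \<le>o |M|" and T: "|\<T>| \<le>o |M|"
  shows "\<exists>E. sticky S E \<and> D0 \<sqsubseteq> E \<and> |E| \<le>o |M| \<and> (\<forall>V\<in>\<T>. handles S E V)"
proof -
  define P where "P n D \<longleftrightarrow> loc_fin S D \<and> |D| \<le>o |M| \<and> (n = 0 \<longrightarrow> D = D0)" for n :: nat and D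
  define Q where "Q D E \<longleftrightarrow> D \<sqsubseteq> E \<and> (\<forall>V\<in>tasks D \<union> \<T>. handles S E V)" for D E
  have "\<exists>f. \<forall>n. P n (f n) \<and> Q (f n) (f (Suc n))"
  proof (rule dependent_nat_choice)
    show "\<exists>D. P 0 D" using D0 by (auto simp: P_def)
  next
    fix D n assume "P n D"
    then have D: "loc_fin S D" "|D| \<le>o |M|" by (simp_all add: P_def)
    have "|tasks D \<union> \<T>| \<le>o |M|"
      by (intro card_of_Un_ordLeq M T card_of_tasks_ordLeq D(2))
    then obtain E where E: "sticky (S - cov D) E" "|E| \<le>o |M|"
        "\<forall>V\<in>tasks D \<union> \<T>. handles (S - cov D) E V"
      using ex[of "S - cov D" "tasks D \<union> \<T>"] S by blast
    have lf: "loc_fin (S - cov D) E" using E(1) by (simp add: sticky_def)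
    note step = loc_fin_step[OF S D(1) lf]
    have "P (Suc n) (D \<union> E)"
      using step(1) card_of_Un_ordLeq[OF M D(2) E(2)] by (simp add: P_def)
    moreover have "Q D (D \<union> E)" using step(2,3) E(3) by (simp add: Q_def)
    ultimately show "\<exists>E. P (Suc n) E \<and> Q D E" by blast
  qed
  then obtain f where f: "\<And>n. P n (f n)" "\<And>n. Q (f n) (f (Suc n))" by blast
  have lf: "loc_fin S (f n)" and ext: "f n \<sqsubseteq> f (Suc n)" and card: "|f n| \<le>o |M|" for n
    using f(1)[of n] f(2)[of n] by (auto simp: P_def Q_def)
  have h: "\<exists>n. handles S (f n) V" if "V \<in> tasks (f m)" for V m
    using f(2)[of m] that by (auto simp: Q_def)
  have f0: "f 0 = D0" using f(1)[of 0] by (simp add: P_def)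
  have "sticky S (\<Union>n. f n)" "D0 \<sqsubseteq> (\<Union>n. f n)"
    using sticky_Union_seq(1)[OF S lf ext h]
      sticky_Union_seq(2)[where D = f and m = 0, OF S lf ext h] by (simp_all add: f0)
  moreover have "|\<Union>n. f n| \<le>o |M|"
    using M card by (intro card_of_UNION_ordLeq_infinite) (auto simp: infinite_iff_card_of_nat)
  moreover have "handles S (\<Union>n. f n) V" if V: "V \<in> \<T>" for V
  proof -
    have "handles S (f (Suc 0)) V" using f(2)[of 0] V by (simp add: Q_def)
    then show ?thesis by (rule handles_mono) auto
  qed
  ultimately show ?thesis by blast
qed

text \<open>
  A sequence of finite sets cannot handle an uncountable family, and in a longer construction
  the limit stages have to be sticky already. Instead, the family is enumerated in the order
  type of its cardinal and one member is handled at a time, passing from the union of the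
  earlier stages to a sticky end extension of it. Every stage has smaller cardinality than the
  whole family, so the extension exists by induction.
\<close>
lemma sticky_exists_infinite:
  assumes "S \<subseteq> topspace Y" and "infinite \<T>"
  shows "\<exists>D. sticky S D \<and> |D| \<le>o |\<T>| \<and> (\<forall>V\<in>\<T>. handles S D V)"
  using assms
proof (induction \<T> arbitrary: S rule: wf_induct_rule[OF wf_inv_image[OF wf_ordLess, of card_of]])
  case (1 \<T>)
  note S = 1(2) and inf = 1(3)
  show ?case
  proof (cases "countable \<T>")
    case True
    then show ?thesis
      using sticky_countable[OF S, of \<T>] countable_ordLeq_infinite inf by blast
  next
    case unc: False
    define r where "r = |\<T>|"
    interpret r: wo_rel r
      unfolding r_def by (simp add: wo_rel_def card_of_Well_order)
    have Fr: "Field r = \<T>" by (simp add: r_def Field_card_of)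
    obtain C0 where C0: "C0 \<subseteq> \<T>" "infinite C0" "countable C0"
      using infinite_countable_subset'[OF inf] by blast
    \<comment> \<open>M t bounds the size of the construction up to stage t;
       C0 keeps it infinite and, being countable, does not raise it to the size of the family.\<close>
    define M where "M t = underS r t \<union> C0" for t
    have uT: "underS r t \<subseteq> \<T>" for t
      unfolding Fr[symmetric] by (auto simp: underS_def Field_def)
    have M_inf: "infinite (M t)" and M_le: "|M t| \<le>o |\<T>|" for t
      using C0 uT by (auto simp: M_def intro!: card_of_mono1)
    have M_less: "|M t| <o |\<T>|" if "t \<in> \<T>" for t
    proof -
      have "|underS r t| <o r"
        using card_of_underS[OF card_of_Card_order[of \<T>, folded r_def], of t] that Fr by simp
      moreover have "\<not> |\<T>| \<le>o |C0|"
        using unc C0(3) by (meson card_of_ordLeq countable_image_inj_on countable_subset)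
      then have "|C0| <o |\<T>|" using not_ordLeq_iff_ordLess card_of_Well_order by blast
      ultimately show ?thesis
        unfolding M_def using inf by (intro card_of_Un_ordLess_infinite) (auto simp: r_def)
    qed
    have extension: "\<exists>E. sticky S E \<and> D \<sqsubseteq> E \<and> |E| \<le>o |M t| \<and> handles S E t"
      if t: "t \<in> \<T>" and D: "loc_fin S D" "|D| \<le>o |M t|" for t D
    proof -
      have "\<exists>D. sticky S' D \<and> |D| \<le>o |M t| \<and> (\<forall>V\<in>\<T>'. handles S' D V)"
        if S': "S' \<subseteq> topspace Y" and T': "|\<T>'| \<le>o |M t|" for S' \<T>'
      proof -
        \<comment> \<open>Adding M t to the tasks is harmless and makes the induction hypothesis, which is
           about infinite families only, applicable to families of any size up to that of M t.\<close>
        have le: "|M t \<union> \<T>'| \<le>o |M t|"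
          using card_of_Un_ordLeq[OF M_inf card_of_mono1[OF subset_refl] T'] .
        then have "(M t \<union> \<T>', \<T>) \<in> inv_image ordLess card_of"
          using M_less[OF t] ordLeq_ordLess_trans by (auto simp: inv_image_def)
        then obtain D where "sticky S' D" "|D| \<le>o |M t \<union> \<T>'|" "\<forall>V\<in>M t \<union> \<T>'. handles S' D V"
          using 1(1)[of "M t \<union> \<T>'" S'] S' M_inf[of t] by blast
        then show ?thesis using le ordLeq_transitive by blast
      qed
      moreover have "|{t}| \<le>o |M t|"
        using M_inf by (intro countable_ordLeq_infinite) auto
      ultimately show ?thesis
        using sticky_extension[OF S M_inf[of t] _ D, of "{t}"] by auto
    qed
    \<comment> \<open>G t is the sticky set after stage t, and H t is the union of the earlier stages.\<close>
    define Q where "Q D t E \<longleftrightarrow> sticky S E \<and> D \<sqsubseteq> E \<and> |E| \<le>o |M t| \<and> handles S E t" for D t E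
    define G where "G = wfrec (r - Id) (\<lambda>g t. SOME E. Q (\<Union>j\<in>underS r t. g j) t E)"
    define H where "H t = (\<Union>j\<in>underS r t. G j)" for t
    have G: "G t = (SOME E. Q (H t) t E)" for t
    proof -
      have "(\<Union>j\<in>underS r t. cut G (r - Id) t j) = H t"
        unfolding H_def by (intro SUP_cong) (auto simp: cut_def underS_def)
      then show ?thesis
        using def_wfrec[OF eq_reflection[OF G_def] r.WF, of t] by simp
    qed
    have total: "s = t \<or> s \<in> underS r t \<or> t \<in> underS r s" if "s \<in> \<T>" "t \<in> \<T>" for s t
      using r.TOTALS that Fr by (auto simp: underS_def)
    have main: "Q (H t) t (G t) \<and> (\<forall>s\<in>underS r t. G s \<sqsubseteq> G t)" if "t \<in> \<T>" for t
      using that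
    proof (induction t rule: wf_induct_rule[OF r.WF])
      case (1 t)
      have IH: "Q (H s) s (G s)" "\<And>s'. s' \<in> underS r s \<Longrightarrow> G s' \<sqsubseteq> G s" if "s \<in> underS r t" for s
        using 1(1)[of s] that uT[of t] by (auto simp: underS_def)
      have st: "sticky S (G s)" if "s \<in> underS r t" for s
        using IH(1)[OF that] by (simp add: Q_def)
      have chain: "C \<sqsubseteq> C' \<or> C' \<sqsubseteq> C" if C: "C \<in> G ` underS r t" "C' \<in> G ` underS r t" for C C'
      proof -
        obtain s s' where s: "s \<in> underS r t" "s' \<in> underS r t" "C = G s" "C' = G s'"
          using C by blast
        then show ?thesis
          using total[of s s'] IH(2) uT[of t] end_ext_refl by blast
      qed
      have ext: "G s \<sqsubseteq> H t" if "s \<in> underS r t" for s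
        unfolding H_def using that chain by (intro end_ext_Union) blast+
      have "loc_fin S (H t)"
      proof (cases "underS r t = {}")
        case True
        then show ?thesis using finite_loc_fin[OF S, of "{}"] by (simp add: H_def)
      next
        case False
        then have "sticky S (H t)"
          unfolding H_def using st chain by (intro sticky_Union_chain_sticky[OF S]) blast+
        then show ?thesis by (simp add: sticky_def)
      qed
      moreover have "|H t| \<le>o |M t|"
        unfolding H_def
      proof (intro card_of_UNION_ordLeq_infinite ballI)
        show "infinite (M t)" by (rule M_inf)
        show "|underS r t| \<le>o |M t|" by (intro card_of_mono1) (auto simp: M_def)
        fix s assume s: "s \<in> underS r t"
        have "M s \<subseteq> M t"
          unfolding M_def using underS_incr[OF r.TRANS r.ANTISYM, of s t] s by (auto simp: underS_def)
        then show "|G s| \<le>o |M t|"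
          using IH(1)[OF s] card_of_mono1 ordLeq_transitive unfolding Q_def by blast
      qed
      ultimately have "\<exists>E. Q (H t) t E" using extension[OF 1(2)] by (simp add: Q_def)
      then have Q: "Q (H t) t (G t)" unfolding G[of t] by (rule someI_ex)
      then have "H t \<sqsubseteq> G t" by (simp add: Q_def)
      with Q ext end_ext_trans show ?case by blast
    qed
    have chain: "C \<sqsubseteq> C' \<or> C' \<sqsubseteq> C" if C: "C \<in> G ` \<T>" "C' \<in> G ` \<T>" for C C'
    proof -
      obtain s s' where "s \<in> \<T>" "s' \<in> \<T>" "C = G s" "C' = G s'"
        using C by blast
      then show ?thesis using total[of s s'] main end_ext_refl by blast
    qed
    have "sticky S (\<Union>t\<in>\<T>. G t)"
      using inf main chain by (intro sticky_Union_chain_sticky[OF S]) (auto simp: Q_def)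
    moreover have "|\<Union>t\<in>\<T>. G t| \<le>o |\<T>|"
    proof (intro card_of_UNION_ordLeq_infinite[OF inf] ballI)
      show "|\<T>| \<le>o |\<T>|" by (intro card_of_mono1) auto
      show "|G t| \<le>o |\<T>|" if "t \<in> \<T>" for t
        using main[OF that] M_le[of t] ordLeq_transitive unfolding Q_def by blast
    qed
    moreover have "handles S (\<Union>t\<in>\<T>. G t) t" if t: "t \<in> \<T>" for t
    proof -
      have "handles S (G t) t" using main[OF t] by (simp add: Q_def)
      then show ?thesis using t by (rule handles_mono[OF _ UN_upper])
    qed
    ultimately show ?thesis by blast
  qed
qed

text \<open>
  Taking the singletons as tasks forces every point to be covered.
\<close>
lemma locally_finite_kernel:
  "\<exists>D \<subseteq> topspace Y. (\<forall>y\<in>topspace Y. \<exists>U. openin Y U \<and> y \<in> U \<and> finite (U \<inter> D)) \<and>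
     topspace Y \<subseteq> (\<Union>y\<in>D. N y)"
proof -
  let ?T = "(\<lambda>y. {y}) ` topspace Y"
  have "\<exists>D. sticky (topspace Y) D \<and> (\<forall>V\<in>?T. handles (topspace Y) D V)"
    using sticky_exists_infinite[OF subset_refl, of ?T]
      sticky_countable[OF subset_refl countable_finite, of ?T] by blast
  then obtain D where D: "sticky (topspace Y) D" "\<forall>V\<in>?T. handles (topspace Y) D V" by blast
  have "topspace Y \<subseteq> cov D" using D(2) N by (auto simp: handles_def)
  then show ?thesis using D(1) by (auto simp: sticky_def loc_fin_def cov_def)
qed

end

unbundle no cardinal_syntax

theorem D_space_if_monolithic:
  assumes "t1_space Y" and "monolithic_operator Y W"
  shows "D_space Y"
  unfolding D_space_def
proof (intro allI impI)
  fix N assume nbhd: "neighborhood_assignment Y N"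
  interpret open_assignment_on_monolithic Y W "\<lambda>y. Y interior_of N y"
    using assms nbhd by unfold_locales (auto simp: neighborhood_assignment_def)
  obtain D where D: "D \<subseteq> topspace Y"
      "\<forall>y\<in>topspace Y. \<exists>U. openin Y U \<and> y \<in> U \<and> finite (U \<inter> D)"
      "topspace Y \<subseteq> (\<Union>y\<in>D. Y interior_of N y)"
    using locally_finite_kernel by blast
  have "closed_discrete_in Y D"
    using closed_discrete_in_if_locally_finite assms(1) D by blast
  moreover have "topspace Y = (\<Union>y\<in>D. N y)"
  proof
    show "topspace Y \<subseteq> (\<Union>y\<in>D. N y)"
      using D(3) by (rule order_trans) (intro UN_mono subset_refl interior_of_subset)
    show "(\<Union>y\<in>D. N y) \<subseteq> topspace Y"
    proof (rule UN_least)
      fix y assume "y \<in> D"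
      then have "y \<in> topspace Y" using D(1) by blast
      then show "N y \<subseteq> topspace Y" using nbhd by (simp add: neighborhood_assignment_def)
    qed
  qed
  ultimately show "\<exists>D. closed_discrete_in Y D \<and> topspace Y = (\<Union>y\<in>D. N y)" by blast
qed

section \<open>Function spaces over Lindeloef \<Sigma>-spaces\<close>

lemma openin_Cp_near:
  assumes "x \<in> topspace X" "open G"
  shows "openin (Cp X) {h \<in> topspace (Cp X). h x \<in> G}"
proof -
  have "continuous_map (Cp X) euclideanreal (\<lambda>h. h x)"
    unfolding Cp_def using assms(1)
    by (intro continuous_map_from_subtopology continuous_map_product_projection)
  then show ?thesis
    using openin_continuous_map_preimage assms(2) by fastforce
qed

lemma Cp_nhd_basis:
  assumes U: "openin (Cp X) U" "f \<in> U"
  obtains E e where "finite E" "E \<subseteq> topspace X" "0 < e"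
    "\<And>h. h \<in> topspace (Cp X) \<Longrightarrow> (\<And>x. x \<in> E \<Longrightarrow> \<bar>h x - f x\<bar> < e) \<Longrightarrow> h \<in> U"
proof -
  let ?I = "topspace X"
  obtain U' where U': "openin (product_topology (\<lambda>_. euclideanreal) ?I) U'"
      "U = U' \<inter> {f. continuous_map X euclideanreal f}"
    using U(1) unfolding Cp_def openin_subtopology by blast
  then obtain B where B: "finite {i \<in> ?I. B i \<noteq> UNIV}" "\<And>i. i \<in> ?I \<Longrightarrow> open (B i)"
      "f \<in> Pi\<^sub>E ?I B" "Pi\<^sub>E ?I B \<subseteq> U'"
    using U(2) unfolding openin_product_topology_alt by auto
  define E where "E = {i \<in> ?I. B i \<noteq> UNIV}"
  have "\<exists>e>0. \<forall>y. \<bar>y - f x\<bar> < e \<longrightarrow> y \<in> B x" if "x \<in> E" for x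
  proof -
    have "open (B x)" "f x \<in> B x" using B that by (auto simp: E_def PiE_iff)
    then show ?thesis unfolding open_dist dist_real_def by blast
  qed
  then obtain d where d: "\<And>x. x \<in> E \<Longrightarrow> d x > 0"
      "\<And>x y. x \<in> E \<Longrightarrow> \<bar>y - f x\<bar> < d x \<Longrightarrow> y \<in> B x"
    by metis
  define e where "e = Min (insert 1 (d ` E))"
  have fin: "finite E" using B by (simp add: E_def)
  have e: "e > 0" "\<And>x. x \<in> E \<Longrightarrow> e \<le> d x" using fin d by (auto simp: e_def)
  show ?thesis
  proof (rule that[of E e])
    show "finite E" "E \<subseteq> ?I" "0 < e" using fin e by (auto simp: E_def)
    fix h assume h: "h \<in> topspace (Cp X)" "\<And>x. x \<in> E \<Longrightarrow> \<bar>h x - f x\<bar> < e"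
    have "h x \<in> B x" if "x \<in> ?I" for x
    proof (cases "x \<in> E")
      case True
      then show ?thesis using h(2)[of x] e(2)[of x] d(2)[of x "h x"] by linarith
    next
      case False
      then show ?thesis using that by (simp add: E_def)
    qed
    then have "h \<in> Pi\<^sub>E ?I B" using h(1) by (auto simp: topspace_Cp PiE_iff)
    then show "h \<in> U" using h(1) B(4) U'(2) by (auto simp: topspace_Cp)
  qed
qed

lemma t1_space_Cp: "t1_space (Cp X)"
  unfolding Cp_def
  by (intro t1_space_subtopology Hausdorff_imp_t1_space)
     (simp add: Hausdorff_space_product_topology)

text \<open>
  A rational datum (F, q, r) turns a finite set B of functions into a constraint on h: at all
  points of F where the members of B agree on being close to q, h has to be close to q too.
  The constraint refers to F and B only, not to the point x of F at which it will be used.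
\<close>
definition confined :: "'a set \<times> real \<times> real \<Rightarrow> ('a \<Rightarrow> real) set \<Rightarrow> ('a \<Rightarrow> real) set" where
  "confined p B = (case p of (F, q, r) \<Rightarrow>
     {h. \<forall>z\<in>F. (\<forall>a\<in>B. \<bar>a z - q\<bar> \<le> r) \<longrightarrow> \<bar>h z - q\<bar> < 2 * r})"

lemma confined_mono: "B \<subseteq> B' \<Longrightarrow> confined p B \<subseteq> confined p B'"
  unfolding confined_def by (cases p) blast

text \<open>
  Let z be a point of K with f z far from q. Since f is a limit of A, some member of A is near
  f at z, hence away from q on a neighborhood of z. Together with the open set where f is
  close to q, these neighborhoods cover K, finitely many of them suffice, and the network of
  the Lindeloef \<Sigma>-space supplies F between K and their union.
\<close>
lemma confining_subset:
  assumes K: "compactin X K" and f: "f \<in> Cp X closure_of A" and A: "A \<subseteq> topspace (Cp X)"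
    and r: "0 < r"
    and net: "\<And>U. openin X U \<Longrightarrow> K \<subseteq> U \<Longrightarrow> \<exists>F\<in>\<F>. K \<subseteq> F \<and> F \<subseteq> U"
  shows "\<exists>F\<in>\<F>. \<exists>B. K \<subseteq> F \<and> finite B \<and> B \<subseteq> A \<and> f \<in> confined (F, q, r) B"
proof -
  let ?U = "{z \<in> topspace X. \<bar>f z - q\<bar> < 2 * r}"
  let ?V = "\<lambda>a. {z \<in> topspace X. \<bar>a z - q\<bar> > r}"
  have cont: "continuous_map X euclideanreal h" if "h \<in> topspace (Cp X)" for h
    using that by (simp add: topspace_Cp)
  have fC: "f \<in> topspace (Cp X)" using f by (simp add: in_closure_of)
  have KX: "K \<subseteq> topspace X" using K by (rule compactin_subset_topspace)
  have "open {y::real. \<bar>y - q\<bar> < 2 * r}" "open {y::real. \<bar>y - q\<bar> > r}"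
    by (intro open_Collect_less continuous_intros)+
  then have "openin X {z \<in> topspace X. h z \<in> {y. \<bar>y - q\<bar> < 2 * r}}"
      "openin X {z \<in> topspace X. h z \<in> {y. \<bar>y - q\<bar> > r}}" if "h \<in> topspace (Cp X)" for h
    using openin_continuous_map_preimage[OF cont[OF that]] by (simp_all only: open_openin)
  then have opU: "openin X ?U" and opV: "\<And>a. a \<in> A \<Longrightarrow> openin X (?V a)"
    using fC A by auto
  have cover: "K \<subseteq> \<Union>(insert ?U (?V ` A))"
  proof
    fix z assume z: "z \<in> K"
    then have zX: "z \<in> topspace X" using KX by blast
    show "z \<in> \<Union>(insert ?U (?V ` A))"
    proof (cases "\<bar>f z - q\<bar> < 2 * r")
      case False
      define H where "H = {h \<in> topspace (Cp X). h z \<in> ball (f z) r}"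
      have "openin (Cp X) H" unfolding H_def by (rule openin_Cp_near[OF zX]) simp
      moreover have "f \<in> H" using fC r by (simp add: H_def)
      ultimately obtain a where "a \<in> A" "a \<in> H"
        using f unfolding in_closure_of by blast
      then have a: "a \<in> A" "a z \<in> ball (f z) r" by (simp_all add: H_def)
      then have "\<bar>a z - q\<bar> > r" using False by (auto simp: dist_real_def)
      then show ?thesis using a(1) zX by blast
    qed (use zX in blast)
  qed
  obtain \<C> where \<C>: "finite \<C>" "\<C> \<subseteq> insert ?U (?V ` A)" "K \<subseteq> \<Union>\<C>"
  proof -
    have "openin X S" if "S \<in> insert ?U (?V ` A)" for S
      using that opU opV by auto
    then show ?thesis using compactinD[OF K _ cover] that by blast
  qed
  then have "finite (\<C> - {?U})" "\<C> - {?U} \<subseteq> ?V ` A" by auto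
  then obtain B where B: "B \<subseteq> A" "finite B" "\<C> - {?U} = ?V ` B"
    by (meson finite_subset_image)
  define G where "G = ?U \<union> (\<Union>a\<in>B. ?V a)"
  have "openin X G" unfolding G_def using opU opV B(1) by blast
  moreover have "K \<subseteq> G" using \<C>(3) B(3) unfolding G_def by blast
  ultimately obtain F where F: "F \<in> \<F>" "K \<subseteq> F" "F \<subseteq> G" using net by blast
  have "f \<in> confined (F, q, r) B"
    using F(3) unfolding confined_def G_def by force
  then show ?thesis using F B by blast
qed

text \<open>
  A basic neighborhood of f restricts finitely many coordinates x. Choosing q x close to f x
  and replacing A by those of its members that are close to q x at all these x, each
  coordinate yields a set F x and a finite set b x that confine f. Conversely, all functions
  so confined by the union B of the b x are close to f at x, because x lies in F x and B was
  taken from the restricted A.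
\<close>
theorem monolithic_operator_Cp:
  assumes "lindelof_Sigma_space X"
  shows "\<exists>W. monolithic_operator (Cp X) W"
proof -
  obtain \<K> \<F> where \<K>: "\<And>K. K \<in> \<K> \<Longrightarrow> compactin X K" "\<Union>\<K> = topspace X"
    and \<F>: "countable \<F>"
      "\<And>K U. K \<in> \<K> \<Longrightarrow> openin X U \<Longrightarrow> K \<subseteq> U \<Longrightarrow> \<exists>F\<in>\<F>. K \<subseteq> F \<and> F \<subseteq> U"
    using assms unfolding lindelof_Sigma_space_def by metis
  define P where "P = {Q. finite Q \<and> Q \<subseteq> \<F> \<times> (\<rat> :: real set) \<times> (\<rat> :: real set)}"
  define W where "W B = (\<lambda>Q. topspace (Cp X) \<inter> (\<Inter>p\<in>Q. confined p B)) ` P" for B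
  have "countable P"
    unfolding P_def using \<F>(1) countable_rat
    by (intro countable_Collect_finite_subset countable_SIGMA) auto
  then have "countable (W B)" for B by (simp add: W_def)
  moreover have "\<exists>B V. finite B \<and> B \<subseteq> A \<and> V \<in> W B \<and> f \<in> V \<and> V \<subseteq> U"
    if A: "A \<subseteq> topspace (Cp X)" and f: "f \<in> Cp X closure_of A"
      and U: "openin (Cp X) U" "f \<in> U" for A f U
  proof -
    have fC: "f \<in> topspace (Cp X)" using f by (simp add: in_closure_of)
    obtain E e where E: "finite E" "E \<subseteq> topspace X" and e: "0 < e"
      and EU: "\<And>h. h \<in> topspace (Cp X) \<Longrightarrow> (\<And>x. x \<in> E \<Longrightarrow> \<bar>h x - f x\<bar> < e) \<Longrightarrow> h \<in> U"
      using Cp_nhd_basis[OF U] by metis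
    \<comment> \<open>Confined functions are within 2 * r of q x and f is within r of it, whence the factor 3.\<close>
    obtain r where r: "r \<in> \<rat>" "0 < r" "r < e / 3"
      using Rats_dense_in_real[of 0 "e / 3"] e by auto
    have "\<exists>q\<in>\<rat>. \<bar>f x - q\<bar> < r" for x
      using Rats_dense_in_real[of "f x - r" "f x + r"] r by force
    then obtain q where q: "\<And>x. q x \<in> \<rat>" "\<And>x. \<bar>f x - q x\<bar> < r" by metis
    \<comment> \<open>Members of A outside this neighborhood of f are discarded; those left satisfy the premise
       of the constraints (F x, q x, r) at the points x of E.\<close>
    define G where "G = topspace (Cp X) \<inter> (\<Inter>x\<in>E. {h \<in> topspace (Cp X). h x \<in> ball (q x) r})"
    have G: "openin (Cp X) G" "f \<in> G"
    proof -
      have "openin (Cp X) {h \<in> topspace (Cp X). h x \<in> ball (q x) r}" if "x \<in> E" for x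
        using that E(2) by (intro openin_Cp_near) auto
      then show "openin (Cp X) G" unfolding G_def using E(1)
        by (cases "E = {}") (auto intro!: openin_Int openin_INT2)
      show "f \<in> G" using fC q(2) by (auto simp: G_def dist_real_def abs_minus_commute)
    qed
    define A' where "A' = G \<inter> A"
    have f': "f \<in> Cp X closure_of A'"
      using openin_Int_closure_of_subset[OF G(1), of A] f G(2) by (auto simp: A'_def)
    have A': "A' \<subseteq> topspace (Cp X)" using A by (auto simp: A'_def)
    have near: "\<bar>a x - q x\<bar> \<le> r" if "a \<in> A'" "x \<in> E" for a x
      using that by (auto simp: A'_def G_def dist_real_def)
    have "\<exists>F B. F \<in> \<F> \<and> x \<in> F \<and> finite B \<and> B \<subseteq> A' \<and> f \<in> confined (F, q x, r) B"
      if x: "x \<in> E" for x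
    proof -
      obtain K where K: "K \<in> \<K>" "x \<in> K" using x E(2) \<K>(2) by blast
      show ?thesis
        using confining_subset[OF \<K>(1)[OF K(1)] f' A' r(2) \<F>(2)[OF K(1)], of "q x"] K(2) by blast
    qed
    then obtain F b where Fb: "\<And>x. x \<in> E \<Longrightarrow> F x \<in> \<F> \<and> x \<in> F x \<and> finite (b x) \<and> b x \<subseteq> A' \<and>
                                f \<in> confined (F x, q x, r) (b x)"
      by metis
    define B where "B = (\<Union>x\<in>E. b x)"
    define Q where "Q = (\<lambda>x. (F x, q x, r)) ` E"
    define V where "V = topspace (Cp X) \<inter> (\<Inter>p\<in>Q. confined p B)"
    have B: "finite B" "B \<subseteq> A'" using Fb E(1) by (auto simp: B_def)
    have "Q \<in> P" using E(1) Fb q(1) r(1) by (auto simp: Q_def P_def)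
    then have "V \<in> W B" by (auto simp: V_def W_def)
    moreover have "f \<in> V"
    proof -
      have "f \<in> confined (F x, q x, r) B" if "x \<in> E" for x
        using Fb[OF that] confined_mono[of "b x" B] that by (auto simp: B_def)
      then show ?thesis using fC by (auto simp: V_def Q_def)
    qed
    moreover have "V \<subseteq> U"
    proof
      fix h assume h: "h \<in> V"
      show "h \<in> U"
      proof (rule EU)
        show "h \<in> topspace (Cp X)" using h by (simp add: V_def)
        fix x assume x: "x \<in> E"
        then have "h \<in> confined (F x, q x, r) B" using h by (auto simp: V_def Q_def)
        moreover have "x \<in> F x" "\<forall>a\<in>B. \<bar>a x - q x\<bar> \<le> r" using Fb[OF x] near B(2) x by auto
        ultimately have "\<bar>h x - q x\<bar> < 2 * r" by (simp add: confined_def)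
        then show "\<bar>h x - f x\<bar> < e" using q(2)[of x] r(3) by linarith
      qed
    qed
    moreover have "B \<subseteq> A" using B(2) by (auto simp: A'_def)
    ultimately show ?thesis using B(1) by blast
  qed
  ultimately have "monolithic_operator (Cp X) W" by (simp add: monolithic_operator_def)
  then show ?thesis by (rule exI[of _ W])
qed

theorem proposition2p7:
  fixes X :: "'a topology"
  assumes "lindelof_Sigma_space X"
  shows "\<forall>S. S \<subseteq> topspace (Cp X) \<longrightarrow> D_space (subtopology (Cp X) S)"
proof (intro allI impI)
  fix S assume S: "S \<subseteq> topspace (Cp X)"
  obtain W where "monolithic_operator (Cp X) W"
    using monolithic_operator_Cp[OF assms] by blast
  then have "monolithic_operator (subtopology (Cp X) S) (\<lambda>B. (\<inter>) S ` W B)"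
    using S by (rule monolithic_operator_subtopology)
  with t1_space_subtopology[OF t1_space_Cp] show "D_space (subtopology (Cp X) S)"
    by (rule D_space_if_monolithic)
qed

end
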